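(* Consider an irrotational regular wave train over a flat bed $y=-d$ with a uniform underlying current of strength $k\neq 0$, where $c>0$ is the wave speed, and let $$p(x,y)=P(x,y)-(P_{atm}-\rho g y)$$ be its dynamic pressure on the fluid domain $D=\{(x,y): x\in\mathbb{R},\ -d\le y\le \eta(x)\}$. Then: (1) if $k\neq c$, the dynamic pressure $p$ attains its maximum value over $D$ at the wave crest $(0,\eta(0))$ and its minimum value over $D$ at the wave trough $(L/2,\eta(L/2))$ (up to translation by the period $L$ in $x$); (2) if $k=c$, the dynamic pressure $p$ is identically zero on $D$.
   Context: Setting: two-dimensional steady periodic irrotational gravity water waves over a homogeneous fluid, written in a frame moving with the wave at constant speed $c>0$, so that the flow is steady. The $x$-axis points in the direction of wave propagation and the $y$-axis vertically upwards. Constants: wave speed $c>0$, period $L>0$, density $\rho>0$, gravitational acceleration $g>0$, atmospheric pressure $P_{atm}$, and mean water depth $d>0$. The flat impermeable bed is $y=-d$ and the free surface is $y=\eta(x)$ with $\eta(x)>-d$. Since $d$ is the mean water depth, $\eta$ has mean zero: $\int_0^L\eta(x)\,dx=0$. The unknowns are $\eta(x)$, the velocity field $(u(x,y),v(x,y))$ and the pressure $P(x,y)$, all $L$-periodic in $x$. Governing equations: $$(u-c)u_x+vu_y=-\tfrac1\rho P_x,\qquad (u-c)v_x+vv_y=-\tfrac1\rho P_y-g,\qquad u_x+v_y=0,\qquad u_y=v_x \qquad \text{for } -d\le y\le\eta(x),$$ $$v=0\ \text{ on } y=-d,\qquad v=(u-c)\eta_x\ \text{ on } y=\eta(x),\qquad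 P=P_{atm}\ \text{ on } y=\eta(x).$$ A regular wave train is a smooth solution $(\eta,u,v,P)$ of these governing equations such that: (i) $u$ and $v$ have a single crest and trough per period; (ii) $\eta$ is strictly monotone between successive crests and troughs; (iii) $\eta$, $u$ and $P$ are symmetric and $v$ is antisymmetric about the crest line. The convention is that the crest is located at $x=0$ and the trough at $x=L/2$. Thus $\eta$ is strictly decreasing on $[0,L/2]$, $\eta,u,P$ are even in $x$, and $v$ is odd in $x$. The strength of the uniform underlying current is $$k=\frac1L\int_0^L u(x,-d)\,dx .$$ By irrotationality and periodicity this equals $\frac1L\int_0^L u(x,y_0)\,dx$ for every $y_0\in[-d,\eta(L/2)]$. *)

theory Defs
  imports "HOL-Analysis.Analysis"
begin

definition fluid_domain :: "real \<Rightarrow> (real \<Rightarrow> real) \<Rightarrow> (real \<times> real) set" where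
  "fluid_domain d \<eta> = {(x, y). - d \<le> y \<and> y \<le> \<eta> x}"

text \<open>Partial derivatives on a closed set \<open>D\<close>, taken from the total derivative within \<open>D\<close>, since
  a horizontal line can meet the fluid domain in a single point (at the crest). For a fluid
  domain below a smooth graph the derivative within \<open>D\<close> is unique, also at boundary points,
  so the choice made by \<^const>\<open>frechet_derivative\<close> is immaterial.\<close>

definition partial_x :: "(real \<times> real) set \<Rightarrow> (real \<times> real \<Rightarrow> real) \<Rightarrow> real \<times> real \<Rightarrow> real" where
  "partial_x D f z = frechet_derivative f (at z within D) (1, 0)"

definition partial_y :: "(real \<times> real) set \<Rightarrow> (real \<times> real \<Rightarrow> real) \<Rightarrow> real \<times> real \<Rightarrow> real" where
  "partial_y D f z = frechet_derivative f (at z within D) (0, 1)"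

fun Ck_on :: "nat \<Rightarrow> (real \<times> real) set \<Rightarrow> (real \<times> real \<Rightarrow> real) \<Rightarrow> bool" where
  "Ck_on 0 D f \<longleftrightarrow> continuous_on D f"
| "Ck_on (Suc n) D f \<longleftrightarrow> f differentiable_on D \<and> Ck_on n D (partial_x D f) \<and> Ck_on n D (partial_y D f)"

text \<open>Smooth up to the boundary of \<open>D\<close>.\<close>

definition smooth_on :: "(real \<times> real) set \<Rightarrow> (real \<times> real \<Rightarrow> real) \<Rightarrow> bool" where
  "smooth_on D f \<longleftrightarrow> (\<forall>n. Ck_on n D f)"

definition smooth :: "(real \<Rightarrow> real) \<Rightarrow> bool" where
  "smooth f \<longleftrightarrow> (\<forall>n. (deriv ^^ n) f differentiable_on UNIV)"

text \<open>The Euler equations, incompressibility, irrotationality and the boundary conditions in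
  the frame moving with speed \<open>c\<close>. A pair \<open>z = (x, y)\<close> is a point of the fluid, and the fields
  \<open>u\<close>, \<open>v\<close>, \<open>P\<close> are only ever constrained on the fluid domain.\<close>

definition governing_equations ::
  "real \<Rightarrow> real \<Rightarrow> real \<Rightarrow> real \<Rightarrow> real \<Rightarrow> (real \<Rightarrow> real) \<Rightarrow>
   (real \<times> real \<Rightarrow> real) \<Rightarrow> (real \<times> real \<Rightarrow> real) \<Rightarrow> (real \<times> real \<Rightarrow> real) \<Rightarrow> bool" where
  "governing_equations c \<rho> g P\<^sub>a\<^sub>t\<^sub>m d \<eta> u v P \<longleftrightarrow>
    (let D = fluid_domain d \<eta> in
      (\<forall>z\<in>D.
         (u z - c) * partial_x D u z + v z * partial_y D u z = - (1 / \<rho>) * partial_x D P z \<and>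
         (u z - c) * partial_x D v z + v z * partial_y D v z = - (1 / \<rho>) * partial_y D P z - g \<and>
         partial_x D u z + partial_y D v z = 0 \<and>
         partial_y D u z = partial_x D v z) \<and>
      (\<forall>x. v (x, - d) = 0) \<and>
      (\<forall>x. v (x, \<eta> x) = (u (x, \<eta> x) - c) * deriv \<eta> x) \<and>
      (\<forall>x. P (x, \<eta> x) = P\<^sub>a\<^sub>t\<^sub>m))"

text \<open>For an \<open>L\<close>-periodic profile: one local maximum point and one local minimum point in
  each period.\<close>

definition single_crest_and_trough :: "real \<Rightarrow> (real \<Rightarrow> real) \<Rightarrow> bool" where
  "single_crest_and_trough L f \<longleftrightarrow>
     (\<exists>!x. x \<in> {0..<L} \<and> (\<forall>\<^sub>F t in nhds x. f t \<le> f x)) \<and>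
     (\<exists>!x. x \<in> {0..<L} \<and> (\<forall>\<^sub>F t in nhds x. f x \<le> f t))"

text \<open>The velocity components are required to have a single crest and trough per period as
  functions of \<open>x\<close> along each horizontal line contained in the fluid domain, that is, at each
  height from the bed up to the trough level. The bed is left out for \<open>v\<close>, which vanishes there.
  The crest line is \<open>x = 0\<close> and the trough line is \<open>x = L / 2\<close>.\<close>

definition regular_wave_train ::
  "real \<Rightarrow> real \<Rightarrow> real \<Rightarrow> real \<Rightarrow> real \<Rightarrow> real \<Rightarrow> (real \<Rightarrow> real) \<Rightarrow>
   (real \<times> real \<Rightarrow> real) \<Rightarrow> (real \<times> real \<Rightarrow> real) \<Rightarrow> (real \<times> real \<Rightarrow> real) \<Rightarrow> bool" where
  "regular_wave_train c L \<rho> g P\<^sub>a\<^sub>t\<^sub>m d \<eta> u v P \<longleftrightarrow>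
    (let D = fluid_domain d \<eta> in
      (\<forall>x. - d < \<eta> x) \<and>
      (\<forall>x. \<eta> (x + L) = \<eta> x) \<and>
      integral {0..L} \<eta> = 0 \<and>
      (\<forall>(x, y)\<in>D. u (x + L, y) = u (x, y) \<and> v (x + L, y) = v (x, y) \<and> P (x + L, y) = P (x, y)) \<and>
      smooth \<eta> \<and> smooth_on D u \<and> smooth_on D v \<and> smooth_on D P \<and>
      governing_equations c \<rho> g P\<^sub>a\<^sub>t\<^sub>m d \<eta> u v P \<and>
      (\<forall>y\<in>{- d..\<eta> (L / 2)}. single_crest_and_trough L (\<lambda>x. u (x, y))) \<and>
      (\<forall>y\<in>{- d<..\<eta> (L / 2)}. single_crest_and_trough L (\<lambda>x. v (x, y))) \<and>
      strict_antimono_on {0..L / 2} \<eta> \<and>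
      (\<forall>x. \<eta> (- x) = \<eta> x) \<and>
      (\<forall>(x, y)\<in>D. u (- x, y) = u (x, y) \<and> v (- x, y) = - v (x, y) \<and> P (- x, y) = P (x, y)))"

definition current_strength :: "real \<Rightarrow> real \<Rightarrow> (real \<times> real \<Rightarrow> real) \<Rightarrow> real" where
  "current_strength L d u = 1 / L * integral {0..L} (\<lambda>x. u (x, - d))"

definition dynamic_pressure ::
  "real \<Rightarrow> real \<Rightarrow> real \<Rightarrow> (real \<times> real \<Rightarrow> real) \<Rightarrow> real \<times> real \<Rightarrow> real" where
  "dynamic_pressure \<rho> g P\<^sub>a\<^sub>t\<^sub>m P = (\<lambda>(x, y). P (x, y) - (P\<^sub>a\<^sub>t\<^sub>m - \<rho> * g * y))"

end

theory Submission
  imports Defs "HOL-Complex_Analysis.Complex_Analysis"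
begin

text \<open>Bernoulli's law turns the dynamic pressure into a constant minus \<open>\<rho> / 2\<close> times the squared
  speed \<open>(u - c)\<^sup>2 + v\<^sup>2\<close>, while on the surface it equals \<open>\<rho> g \<eta>\<close>. The complex velocity
  \<open>(u - c) - \<i> v\<close> is holomorphic, real on the bed, and hence extends across the bed by Schwarz
  reflection; by the open mapping theorem neither \<open>u\<close> nor the squared speed is extremal below the
  surface, except for a minimum of the latter at a stagnation point. A surface point with \<open>u = c\<close>
  is a stagnation point, so it sits at the crest. Thus \<open>u - c\<close> has one sign on the surface, and
  then, strictly, everywhere below. This excludes stagnation points below the surface, so the
  pressure is extremal only on the surface, where its extrema are those of \<open>\<eta>\<close>. It also shows
  \<open>k \<noteq> c\<close>: because \<open>\<eta>\<close> is strictly monotone from crest to trough, case (2) is vacuous.\<close>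

section \<open>Cauchy-Riemann equations and points of open sets in the complex plane\<close>

text \<open>A real-linear map of the plane is fixed by its values at \<open>(1, 0)\<close> and
  \<open>(0, 1)\<close>. The Cauchy-Riemann equations \<open>cr\<close> make it multiplication by
  one complex number.\<close>

lemma has_field_derivative_Complex_pair:
  fixes a b :: "real \<times> real \<Rightarrow> real"
  assumes a: "(a has_derivative a') (at (Re z, Im z))"
    and b: "(b has_derivative b') (at (Re z, Im z))"
    and cr: "a' (1, 0) = b' (0, 1)" "a' (0, 1) = - b' (1, 0)"
  shows "((\<lambda>z. Complex (a (Re z, Im z)) (b (Re z, Im z))) has_field_derivative
           Complex (a' (1, 0)) (b' (1, 0))) (at z)"
proof -
  have pair: "f' (s, t) = s * f' (1, 0) + t * f' (0, 1)" if "bounded_linear f'"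
    for f' :: "real \<times> real \<Rightarrow> real" and s t
  proof -
    interpret bounded_linear f' by fact
    have "f' (s, t) = f' (s *\<^sub>R (1, 0) + t *\<^sub>R (0, 1))" by simp
    then show ?thesis by (simp only: add scaleR) simp
  qed
  have coord: "((\<lambda>z. (Re z, Im z)) has_derivative (\<lambda>h. (Re h, Im h))) (at z)"
    by (auto intro!: derivative_eq_intros)
  have "((\<lambda>z. complex_of_real (a (Re z, Im z)) + \<i> * complex_of_real (b (Re z, Im z)))
      has_derivative (\<lambda>h. complex_of_real (a' (Re h, Im h)) + \<i> * complex_of_real (b' (Re h, Im h)))) (at z)"
    by (intro derivative_intros has_derivative_compose[OF coord] a b)
  moreover have "complex_of_real (a' (Re h, Im h)) + \<i> * complex_of_real (b' (Re h, Im h))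
      = Complex (a' (1, 0)) (b' (1, 0)) * h" for h
    using pair[OF has_derivative_bounded_linear[OF a], of "Re h" "Im h"]
      pair[OF has_derivative_bounded_linear[OF b], of "Re h" "Im h"] cr
    by (simp add: complex_eq_iff algebra_simps)
  ultimately show ?thesis
    by (simp add: has_field_derivative_def Complex_eq)
qed

lemma open_exists_Re_less:
  assumes "open T" "w \<in> T"
  shows "\<exists>w'\<in>T. Re w' < Re w"
proof -
  obtain e where "e > 0" "cball w e \<subseteq> T"
    using assms by (meson open_contains_cball)
  then show ?thesis
    by (intro bexI[of _ "w - of_real e"]) (auto simp: dist_norm)
qed

lemma open_exists_Re_greater:
  assumes "open T" "w \<in> T"
  shows "\<exists>w'\<in>T. Re w < Re w'"
proof -
  obtain e where "e > 0" "cball w e \<subseteq> T"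
    using assms by (meson open_contains_cball)
  then show ?thesis
    by (intro bexI[of _ "w + of_real e"]) (auto simp: dist_norm)
qed

text \<open>A short radial step outwards increases the norm. At 0, where there is no radial
  direction, any step does.\<close>

lemma open_exists_norm_greater:
  fixes w :: complex
  assumes "open T" "w \<in> T"
  shows "\<exists>w'\<in>T. norm w < norm w'"
proof -
  obtain e where e: "e > 0" "cball w e \<subseteq> T"
    using assms by (meson open_contains_cball)
  show ?thesis
  proof (cases "w = 0")
    case True
    with e show ?thesis
      by (intro bexI[of _ "of_real e"]) (auto simp: dist_norm)
  next
    case False
    have "w + of_real e * sgn w = of_real (norm w + e) * sgn w"
      by (simp add: sgn_eq algebra_simps add_divide_distrib)
    with e False have "norm (w + of_real e * sgn w) = norm w + e"
      by (simp only: norm_mult norm_sgn norm_of_real) simp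
    with e False show ?thesis
      by (intro bexI[of _ "w + of_real e * sgn w"]) (auto simp: dist_norm norm_mult norm_sgn)
  qed
qed

lemma open_exists_norm_less:
  fixes w :: complex
  assumes "open T" "w \<in> T" "w \<noteq> 0"
  shows "\<exists>w'\<in>T. norm w' < norm w"
proof -
  obtain e where e: "e > 0" "cball w e \<subseteq> T"
    using assms by (meson open_contains_cball)
  \<comment> \<open>The inward step stays in the ball and does not overshoot the origin, so that the
    new norm is exactly \<open>norm w - r\<close>.\<close>
  define r where "r = min e (norm w)"
  have r: "0 < r" "r \<le> e" "r \<le> norm w"
    using e assms by (auto simp: r_def)
  have "w - of_real r * sgn w = of_real (norm w - r) * sgn w"
    using \<open>w \<noteq> 0\<close> by (simp add: sgn_eq algebra_simps diff_divide_distrib)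
  then have "norm (w - of_real r * sgn w) = norm w - r"
    using r \<open>w \<noteq> 0\<close> by (simp only: norm_mult norm_sgn norm_of_real) simp
  with e r \<open>w \<noteq> 0\<close> show ?thesis
    by (intro bexI[of _ "w - of_real r * sgn w"]) (auto simp: dist_norm norm_mult norm_sgn)
qed

section \<open>Periodic functions and extrema over periodic domains\<close>

lemma periodic_int_shift:
  fixes f :: "real \<Rightarrow> 'a"
  assumes "\<And>x. f (x + L) = f x"
  shows "f (x + of_int n * L) = f x"
proof (induction n)
  case (nonneg n)
  show ?case
  proof (induction n)
    case (Suc n)
    have "f (x + of_int (int (Suc n)) * L) = f ((x + of_int (int n) * L) + L)"
      by (simp add: algebra_simps)
    with Suc assms show ?case by metis
  qed simp
next
  case (neg n)
  \<comment> \<open>The case concerns only \<open>- int (Suc n)\<close>; the inner induction needs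
    the base 0 as well.\<close>
  have *: "f (x + of_int (- int m) * L) = f x" for m
  proof (induction m)
    case (Suc m)
    have "f (x + of_int (- int (Suc m)) * L) = f ((x + of_int (- int (Suc m)) * L) + L)"
      using assms by simp
    also have "\<dots> = f (x + of_int (- int m) * L)" by (simp add: algebra_simps)
    finally show ?case using Suc by simp
  qed simp
  show ?case by (rule *)
qed

lemma exists_int_shift_in_period:
  fixes x L :: real
  assumes "L > 0"
  obtains n :: int where "x + of_int n * L \<in> {0..L}"
proof
  have "x + of_int (- \<lfloor>x / L\<rfloor>) * L = frac (x / L) * L"
    using assms by (simp add: frac_def field_simps)
  then show "x + of_int (- \<lfloor>x / L\<rfloor>) * L \<in> {0..L}"
    using assms frac_ge_0[of "x / L"] frac_lt_1[of "x / L"] by (auto intro: mult_left_le_one_le)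
qed

text \<open>The nearest multiple of \<open>L\<close> lies at most half a period away.\<close>

lemma exists_int_shift_centered:
  fixes x L :: real
  assumes "L > 0"
  obtains n :: int where "\<bar>x - of_int n * L\<bar> \<le> L / 2"
proof -
  have "\<bar>x / L - of_int (round (x / L))\<bar> \<le> 1 / 2"
    using of_int_round_abs_le[of "x / L"] by (simp add: abs_minus_commute)
  then have "\<bar>x / L - of_int (round (x / L))\<bar> * L \<le> 1 / 2 * L"
    using assms by (intro mult_right_mono) auto
  also have "\<bar>x / L - of_int (round (x / L))\<bar> * L = \<bar>(x / L - of_int (round (x / L))) * L\<bar>"
    using assms by (simp add: abs_mult)
  also have "(x / L - of_int (round (x / L))) * L = x - of_int (round (x / L)) * L"
    using assms by (simp add: field_simps)
  finally show ?thesis by (intro that) simp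
qed

text \<open>\<open>S\<close> is unbounded, but its part \<open>K\<close> over one closed period is
  compact; periodicity carries the minimum over \<open>K\<close> to all of \<open>S\<close>.\<close>

lemma continuous_on_periodic_attains_inf:
  fixes f :: "real \<times> real \<Rightarrow> real"
  assumes "L > 0" and h: "continuous_on UNIV h" "\<And>x. h (x + L) = h x" "\<And>x. b \<le> h x"
    and S: "S = {(x, y). b \<le> y \<and> y \<le> h x}"
    and f: "continuous_on S f" "\<And>x y. (x, y) \<in> S \<Longrightarrow> f (x + L, y) = f (x, y)"
  shows "\<exists>z\<in>S. \<forall>z'\<in>S. f z \<le> f z'"
proof -
  define K where "K = S \<inter> {0..L} \<times> UNIV"
  have "continuous_on {0..L} h" using h(1) continuous_on_subset by blast
  then have "compact (h ` {0..L})" using compact_continuous_image by blast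
  then obtain M where M: "\<And>x. x \<in> {0..L} \<Longrightarrow> h x \<le> M"
    by (metis bdd_above.E bounded_imp_bdd_above compact_imp_bounded image_eqI)
  have "closed S"
  proof -
    have "S = {z. b \<le> snd z} \<inter> {z. snd z \<le> h (fst z)}" using S by auto
    moreover have "closed {z. snd z \<le> h (fst z)}"
      by (intro closed_Collect_le continuous_intros continuous_on_compose2[OF h(1)]) auto
    ultimately show ?thesis
      by (auto intro!: closed_Int closed_Collect_le continuous_intros)
  qed
  moreover have "K = S \<inter> {0..L} \<times> {b..M}"
    using M S by (force simp: K_def)
  ultimately have "compact K"
    by (auto intro!: closed_Int_compact compact_Times)
  moreover have "K \<noteq> {}"
  proof -
    have "(0, b) \<in> K" using h(3) \<open>L > 0\<close> S by (auto simp: K_def)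
    then show ?thesis by auto
  qed
  moreover have "continuous_on K f" using f(1) by (rule continuous_on_subset) (auto simp: K_def)
  ultimately obtain z where z: "z \<in> K" "\<And>z'. z' \<in> K \<Longrightarrow> f z \<le> f z'"
    using continuous_attains_inf[of K f] by auto
  have "f z \<le> f (x, y)" if xy: "(x, y) \<in> S" for x y
  proof -
    obtain n :: int where n: "x + of_int n * L \<in> {0..L}"
      using exists_int_shift_in_period[OF \<open>L > 0\<close>] .
    define x' where "x' = x + of_int n * L"
    have "0 \<le> x'" "x' \<le> L" using n by (auto simp: x'_def)
    moreover have "h x' = h x" using periodic_int_shift[of h L, OF h(2)] by (simp add: x'_def)
    ultimately have "(x', y) \<in> K" using xy S by (auto simp: K_def)
    moreover have "f (x', y) = f (x, y)"
    proof -
      \<comment> \<open>\<open>f\<close> is known to be periodic only on \<open>S\<close>. Extension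
        by 0 gives a function periodic on the whole line, to which \<open>periodic_int_shift\<close>
        applies.\<close>
      define \<phi> where "\<phi> = (\<lambda>x. if (x, y) \<in> S then f (x, y) else 0)"
      have "\<phi> (x + L) = \<phi> x" for x
        using f(2)[of x y] h(2)[of x] S by (auto simp: \<phi>_def)
      then have "\<phi> x' = \<phi> x" unfolding x'_def by (rule periodic_int_shift)
      moreover have "(x', y) \<in> S" using \<open>(x', y) \<in> K\<close> by (simp add: K_def)
      ultimately show ?thesis using xy by (simp add: \<phi>_def)
    qed
    ultimately show ?thesis using z(2) by metis
  qed
  with z(1) show ?thesis by (intro bexI[of _ z]) (auto simp: K_def)
qed

lemma linear_zero_pairI:
  fixes f :: "real \<times> real \<Rightarrow> real"
  assumes "bounded_linear f" "f (1, 0) = 0" "f (0, 1) = 0"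
  shows "f = (\<lambda>_. 0)"
proof
  fix h :: "real \<times> real"
  interpret bounded_linear f by fact
  have "f h = f (fst h *\<^sub>R (1, 0) + snd h *\<^sub>R (0, 1))" by (simp add: case_prod_beta)
  then show "f h = 0" by (simp only: add scaleR assms) simp
qed

section \<open>The fluid domain and the regularity of the fields\<close>

locale wave_train =
  fixes c L \<rho> g P\<^sub>a d :: real and \<eta> :: "real \<Rightarrow> real" and u v P :: "real \<times> real \<Rightarrow> real"
  assumes L: "L > 0" and \<rho>: "\<rho> > 0" and g: "g > 0"
    and train: "regular_wave_train c L \<rho> g P\<^sub>a d \<eta> u v P"
begin

abbreviation D where "D \<equiv> fluid_domain d \<eta>"

text \<open>The bed is included because reflection turns its points into interior points, which the
  open mapping theorem covers.\<close>

definition A where "A = {(x, y). - d \<le> y \<and> y < \<eta> x}"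

definition I where "I = {(x, y). - d < y \<and> y < \<eta> x}"

definition speed_sq where "speed_sq z = (u z - c)\<^sup>2 + (v z)\<^sup>2"

lemma depth_pos: "- d < \<eta> x"
  and \<eta>_periodic: "\<eta> (x + L) = \<eta> x"
  and \<eta>_even: "\<eta> (- x) = \<eta> x"
  and \<eta>_decreasing: "strict_antimono_on {0..L / 2} \<eta>"
  using train by (auto simp: regular_wave_train_def Let_def)

lemma field_periodic:
  assumes "(x, y) \<in> D"
  shows "u (x + L, y) = u (x, y)" "v (x + L, y) = v (x, y)" "P (x + L, y) = P (x, y)"
  using train assms by (auto simp: regular_wave_train_def Let_def)

lemma continuous_\<eta>: "continuous_on UNIV \<eta>"
proof -
  have "(deriv ^^ 0) \<eta> differentiable_on UNIV"
    using train unfolding regular_wave_train_def Let_def smooth_def by blast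
  then show ?thesis by (simp add: differentiable_imp_continuous_on)
qed

lemma differentiable_fields: "u differentiable_on D" "v differentiable_on D" "P differentiable_on D"
proof -
  have "f differentiable_on S" if "smooth_on S f" for f S
    using that[unfolded smooth_on_def, rule_format, of "Suc 0"] by simp
  then show "u differentiable_on D" "v differentiable_on D" "P differentiable_on D"
    using train by (auto simp: regular_wave_train_def Let_def)
qed

lemma continuous_fields: "continuous_on D u" "continuous_on D v" "continuous_on D P"
  using differentiable_fields by (auto intro: differentiable_imp_continuous_on)

lemma bed: "v (x, - d) = 0"
  and kinematic: "v (x, \<eta> x) = (u (x, \<eta> x) - c) * deriv \<eta> x"
  and dynamic: "P (x, \<eta> x) = P\<^sub>a"
  using train by (auto simp: regular_wave_train_def Let_def governing_equations_def)

lemma field_equations: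
  assumes "z \<in> D"
  shows "(u z - c) * partial_x D u z + v z * partial_y D u z = - (1 / \<rho>) * partial_x D P z"
    "(u z - c) * partial_x D v z + v z * partial_y D v z = - (1 / \<rho>) * partial_y D P z - g"
    "partial_x D u z + partial_y D v z = 0"
    "partial_y D u z = partial_x D v z"
  using train assms by (auto simp: regular_wave_train_def Let_def governing_equations_def)

lemma I_subset_A: "I \<subseteq> A" and A_subset_D: "A \<subseteq> D"
  by (auto simp: I_def A_def fluid_domain_def)

lemma open_I: "open I"
proof -
  have "I = {z. - d < snd z} \<inter> {z. snd z < \<eta> (fst z)}" by (auto simp: I_def)
  then show ?thesis
    by (auto intro!: open_Int open_Collect_less continuous_intros continuous_on_compose2[OF continuous_\<eta>])
qed

text \<open>Vertical rescaling maps a straight strip continuously onto \<open>I\<close>.\<close>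

lemma connected_I: "connected I"
proof -
  let ?f = "\<lambda>(x, t). (x, - d + t * (\<eta> x + d))"
  have "(x, y) \<in> ?f ` (UNIV \<times> {0<..<1})" if "(x, y) \<in> I" for x y
  proof -
    have "(x, y) = ?f (x, (y + d) / (\<eta> x + d))" "(y + d) / (\<eta> x + d) \<in> {0<..<1}"
      using that depth_pos[of x] by (auto simp: I_def divide_simps)
    then show ?thesis by blast
  qed
  moreover have "?f (x, t) \<in> I" if "0 < t" "t < 1" for x t
  proof -
    have "0 < t * (\<eta> x + d)" "t * (\<eta> x + d) < 1 * (\<eta> x + d)"
      using that depth_pos[of x] by (auto intro!: mult_pos_pos mult_strict_right_mono)
    then show ?thesis by (simp add: I_def)
  qed
  ultimately have "I = ?f ` (UNIV \<times> {0<..<1})" by force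
  moreover have "continuous_on (UNIV \<times> {0<..<1}) ?f"
    unfolding case_prod_beta
    by (intro continuous_intros continuous_on_compose2[OF continuous_\<eta>]) auto
  moreover have "connected (UNIV \<times> {0<..<1} :: (real \<times> real) set)"
    by (intro connected_Times) auto
  ultimately show ?thesis
    by (simp only: connected_continuous_image)
qed

lemma D_subset_closure_I: "D \<subseteq> closure I"
proof (safe, rename_tac x y)
  fix x y assume "(x, y) \<in> D"
  then have y: "- d \<le> y" "y \<le> \<eta> x" by (auto simp: fluid_domain_def)
  \<comment> \<open>Midway between bed and surface. The points \<open>s n\<close> approach
    \<open>(x, y)\<close> along the vertical segment from this midpoint.\<close>
  define m where "m = (\<eta> x - d) / 2"
  have m: "- d < m" "m < \<eta> x" using depth_pos[of x] by (auto simp: m_def field_simps)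
  define s where "s = (\<lambda>n::nat. (x, y + inverse (real (Suc (Suc n))) * (m - y)))"
  have "s n \<in> I" for n
  proof -
    define t where "t = inverse (real (Suc (Suc n)))"
    have sn: "s n = (x, y + t * (m - y))" by (simp only: s_def t_def)
    have t: "0 < t" "t < 1" by (auto simp: t_def field_simps)
    have "0 < t * (m + d)" "0 < t * (\<eta> x - m)" using t m by auto
    moreover have "0 \<le> (1 - t) * (y + d)" "0 \<le> (1 - t) * (\<eta> x - y)" using t y by auto
    ultimately show ?thesis
      by (simp add: sn I_def algebra_simps)
  qed
  moreover have "s \<longlonglongrightarrow> (x, y + 0 * (m - y))"
    unfolding s_def by (intro tendsto_intros LIMSEQ_Suc[OF LIMSEQ_inverse_real_of_nat])
  ultimately show "(x, y) \<in> closure I"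
    by (metis closure_sequential add_0_right mult_zero_left)
qed

text \<open>Carries identities proved by differentiation in the open set \<open>I\<close> to the bed
  and the surface, by density and continuity.\<close>

lemma const_on_D:
  fixes f :: "real \<times> real \<Rightarrow> real"
  assumes "continuous_on D f" "\<And>z. z \<in> I \<Longrightarrow> f z = a" "z \<in> D"
  shows "f z = a"
proof -
  obtain s where s: "\<And>n. s n \<in> I" "s \<longlonglongrightarrow> z"
    using D_subset_closure_I assms(3) by (meson closure_sequential in_mono)
  then have "(\<lambda>n. f (s n)) \<longlonglongrightarrow> f z"
    using I_subset_A A_subset_D
    by (intro continuous_on_tendsto_compose[OF assms(1) s(2) assms(3)] always_eventually) auto
  moreover have "(\<lambda>n. f (s n)) = (\<lambda>n. a)" using s(1) assms(2) by auto
  ultimately show ?thesis by (simp add: LIMSEQ_const_iff)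
qed

lemma has_derivative_I:
  assumes "f differentiable_on D" "z \<in> I"
  shows "(f has_derivative frechet_derivative f (at z within D)) (at z)"
proof -
  have "z \<in> interior D"
    using open_I I_subset_A A_subset_D assms(2) by (meson interiorI subset_trans)
  then have "at z within D = at z" by (rule at_within_interior)
  moreover have "f differentiable (at z within D)"
    using assms I_subset_A A_subset_D by (auto simp: differentiable_on_def)
  ultimately show ?thesis by (simp add: frechet_derivative_works)
qed

section \<open>Bernoulli's law\<close>

text \<open>Irrotationality lets \<open>v_x\<close> and \<open>u_y\<close> be exchanged in the Euler
  equations, which then say that the gradient of the left side vanishes. Connectedness of
  \<open>I\<close> makes it constant there, continuity on \<open>D\<close>.\<close>

lemma bernoulli: "\<exists>E. \<forall>z\<in>D. P z / \<rho> + speed_sq z / 2 + g * snd z = E"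
proof -
  define H where "H = (\<lambda>z. P z / \<rho> + ((u z - c)\<^sup>2 + (v z)\<^sup>2) / 2 + g * snd z)"
  have zero: "(H has_derivative (\<lambda>_. 0)) (at z)" if z: "z \<in> I" for z
  proof -
    note der = differentiable_fields[THEN has_derivative_I, OF z]
    let ?H' = "\<lambda>h. frechet_derivative P (at z within D) h / \<rho>
      + ((u z - c) * frechet_derivative u (at z within D) h
       + v z * frechet_derivative v (at z within D) h) + g * snd h"
    have "(H has_derivative ?H') (at z)"
      unfolding H_def using \<rho> by (auto intro!: derivative_eq_intros der simp: field_simps)
    moreover have "?H' = (\<lambda>_. 0)"
    proof (rule linear_zero_pairI)
      show "bounded_linear ?H'" using \<open>(H has_derivative ?H') (at z)\<close> by (rule has_derivative_bounded_linear)
      have "z \<in> D" using z I_subset_A A_subset_D by auto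
      note eqs = field_equations[OF this, unfolded partial_x_def partial_y_def]
      show "?H' (1, 0) = 0" "?H' (0, 1) = 0"
        using eqs by (auto simp: algebra_simps)
    qed
    ultimately show ?thesis by simp
  qed
  have "(0, (\<eta> 0 - d) / 2) \<in> I" using depth_pos[of 0] by (auto simp: I_def field_simps)
  then have "H z = H (0, (\<eta> 0 - d) / 2)" if "z \<in> I" for z
    using has_derivative_zero_unique_connected[OF open_I connected_I zero that] by blast
  moreover have "continuous_on D H"
    unfolding H_def using \<rho> by (intro continuous_intros continuous_fields) auto
  ultimately have "H z = H (0, (\<eta> 0 - d) / 2)" if "z \<in> D" for z
    using const_on_D that by blast
  then show ?thesis unfolding H_def speed_sq_def by blast
qed

section \<open>Crests and troughs of the surface profile\<close>

lemma \<eta>_shift: "\<eta> (x + of_int n * L) = \<eta> x"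
  by (rule periodic_int_shift) (rule \<eta>_periodic)

lemma \<eta>_less:
  assumes "0 \<le> x" "x < y" "y \<le> L / 2"
  shows "\<eta> y < \<eta> x"
  using \<eta>_decreasing assms by (auto simp: monotone_on_def)

lemma \<eta>_abs: "\<eta> \<bar>x\<bar> = \<eta> x"
  by (simp add: abs_if \<eta>_even)

text \<open>Periodicity and evenness move any point into \<open>{0..L / 2}\<close>, where \<eta>
  decreases strictly.\<close>

lemma \<eta>_le_crest: "\<eta> x \<le> \<eta> 0"
  and \<eta>_eq_crest_iff: "\<eta> x = \<eta> 0 \<longleftrightarrow> (\<exists>n::int. x = of_int n * L)"
proof -
  obtain n :: int where n: "\<bar>x - of_int n * L\<bar> \<le> L / 2"
    using exists_int_shift_centered[OF L] .
  have eq: "\<eta> \<bar>x - of_int n * L\<bar> = \<eta> x"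
    using \<eta>_shift[of x "- n"] by (simp add: \<eta>_abs)
  show "\<eta> x \<le> \<eta> 0"
    using \<eta>_less[of 0 "\<bar>x - of_int n * L\<bar>"] n eq by fastforce
  have "x = of_int n * L" if "\<eta> x = \<eta> 0"
    using \<eta>_less[of 0 "\<bar>x - of_int n * L\<bar>"] n eq that by fastforce
  moreover have "\<eta> (of_int m * L) = \<eta> 0" for m
    using \<eta>_shift[of 0 m] by simp
  ultimately show "\<eta> x = \<eta> 0 \<longleftrightarrow> (\<exists>n::int. x = of_int n * L)" by auto
qed

lemma \<eta>_ge_trough: "\<eta> (L / 2) \<le> \<eta> x"
  and \<eta>_eq_trough_iff: "\<eta> x = \<eta> (L / 2) \<longleftrightarrow> (\<exists>n::int. x = L / 2 + of_int n * L)"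
proof -
  obtain n :: int where n: "\<bar>x - of_int n * L\<bar> \<le> L / 2"
    using exists_int_shift_centered[OF L] .
  have eq: "\<eta> \<bar>x - of_int n * L\<bar> = \<eta> x"
    using \<eta>_shift[of x "- n"] by (simp add: \<eta>_abs)
  show "\<eta> (L / 2) \<le> \<eta> x"
    using \<eta>_less[of "\<bar>x - of_int n * L\<bar>" "L / 2"] n eq
    by (cases "\<bar>x - of_int n * L\<bar> = L / 2") auto
  \<comment> \<open>The centered representative is \<open>L / 2\<close> or \<open>- L / 2\<close>;
    the latter is the trough one period earlier.\<close>
  have "x = L / 2 + of_int n * L \<or> x = L / 2 + of_int (n - 1) * L" if "\<eta> x = \<eta> (L / 2)"
  proof -
    have "\<bar>x - of_int n * L\<bar> = L / 2"
      using \<eta>_less[of "\<bar>x - of_int n * L\<bar>" "L / 2"] n eq that by fastforce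
    then show ?thesis using L by (auto simp: abs_if algebra_simps split: if_splits)
  qed
  moreover have "\<eta> (L / 2 + of_int m * L) = \<eta> (L / 2)" for m
    by (rule \<eta>_shift)
  ultimately show "\<eta> x = \<eta> (L / 2) \<longleftrightarrow> (\<exists>n::int. x = L / 2 + of_int n * L)" by metis
qed

section \<open>The complex velocity and the open mapping theorem\<close>

text \<open>With constant speed and constant surface pressure, Bernoulli's law would put crest and
  trough at the same height. This supplies the nonconstancy required by the open mapping
  theorem.\<close>

lemma speed_sq_not_const:
  assumes "\<And>z. z \<in> I \<Longrightarrow> speed_sq z = a"
  shows False
proof -
  obtain E where E: "\<And>z. z \<in> D \<Longrightarrow> P z / \<rho> + speed_sq z / 2 + g * snd z = E"
    using bernoulli by blast
  have "continuous_on D speed_sq"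
    unfolding speed_sq_def by (intro continuous_intros continuous_fields)
  then have const: "speed_sq z = a" if "z \<in> D" for z
    using const_on_D assms that by blast
  have surface: "(x, \<eta> x) \<in> D" for x using depth_pos[of x] by (auto simp: fluid_domain_def)
  have "g * \<eta> 0 = g * \<eta> (L / 2)"
    using E[OF surface[of 0]] E[OF surface[of "L / 2"]] const[OF surface[of 0]]
      const[OF surface[of "L / 2"]] unfolding dynamic snd_conv by linarith
  then show False using \<eta>_less[of 0 "L / 2"] L g by auto
qed

text \<open>Incompressibility and irrotationality are the Cauchy-Riemann equations of
  \<open>(u - c) - i v\<close>.\<close>

lemma has_field_derivative_velocity:
  assumes "(Re z, Im z) \<in> I"
  shows "((\<lambda>z. Complex (u (Re z, Im z) - c) (- v (Re z, Im z))) has_field_derivative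
           Complex (partial_x D u (Re z, Im z)) (- partial_x D v (Re z, Im z))) (at z)"
proof -
  have "(Re z, Im z) \<in> D" using assms I_subset_A A_subset_D by auto
  note eqs = field_equations(3,4)[OF this, unfolded partial_x_def partial_y_def]
  note der = differentiable_fields(1,2)[THEN has_derivative_I, OF assms]
  have "((\<lambda>z. u z - c) has_derivative frechet_derivative u (at (Re z, Im z) within D)) (at (Re z, Im z))"
    using has_derivative_diff[OF der(1) has_derivative_const[of c]] by simp
  from has_field_derivative_Complex_pair[OF this has_derivative_minus[OF der(2)]] eqs
  show ?thesis by (simp add: partial_x_def)
qed

text \<open>The set \<open>T\<close> is the range of the reflected complex velocity. Reflection conjugates values,
  which changes neither their real part nor their norm.\<close>

lemma open_velocity_range:
  "\<exists>T. open T \<and> (\<forall>z\<in>A. Complex (u z - c) (- v z) \<in> T) \<and>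
       (\<forall>w\<in>T. \<exists>z\<in>A. Re w = u z - c \<and> (norm w)\<^sup>2 = speed_sq z)"
proof -
  \<comment> \<open>\<open>A\<close> raised by \<open>d\<close>, so that the bed becomes the real
    axis, together with its mirror image.\<close>
  define S where "S = {z. \<bar>Im z\<bar> < \<eta> (Re z) + d}"
  define G where "G z = Complex (u (Re z, Im z - d) - c) (- v (Re z, Im z - d))" for z
  define F where "F z = (if 0 \<le> Im z then G z else cnj (G (cnj z)))" for z
  have "open S"
    unfolding S_def
    by (intro open_Collect_less continuous_intros continuous_on_compose2[OF continuous_\<eta>]) auto
  have "connected S"
  proof -
    let ?f = "\<lambda>(x, t). Complex x (t * (\<eta> x + d))"
    have "z \<in> ?f ` (UNIV \<times> {-1<..<1})" if "z \<in> S" for z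
    proof -
      have "z = ?f (Re z, Im z / (\<eta> (Re z) + d))" "Im z / (\<eta> (Re z) + d) \<in> {-1<..<1}"
        using that depth_pos[of "Re z"] by (auto simp: S_def complex_eq_iff divide_simps)
      then show ?thesis by blast
    qed
    moreover have "?f (x, t) \<in> S" if "-1 < t" "t < 1" for x t
    proof -
      have "\<bar>t\<bar> * (\<eta> x + d) < 1 * (\<eta> x + d)"
        using that depth_pos[of x] by (intro mult_strict_right_mono) auto
      then show ?thesis using depth_pos[of x] by (auto simp: S_def abs_mult)
    qed
    ultimately have "S = ?f ` (UNIV \<times> {-1<..<1})" by force
    moreover have "continuous_on (UNIV \<times> {-1<..<1}) ?f"
      unfolding case_prod_beta Complex_eq
      by (intro continuous_intros continuous_on_compose2[OF continuous_\<eta>]) auto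
    moreover have "connected (UNIV \<times> {-1<..<1} :: (real \<times> real) set)"
      by (intro connected_Times) auto
    ultimately show ?thesis
      by (simp only: connected_continuous_image)
  qed
  have "F holomorphic_on S"
    unfolding F_def
  proof (rule Schwarz_reflection)
    show "open S" by fact
    show "cnj ` S \<subseteq> S" by (auto simp: S_def)
    show "G holomorphic_on S \<inter> {z. 0 < Im z}"
      unfolding holomorphic_on_open[OF open_Int[OF \<open>open S\<close> open_halfspace_Im_gt]]
    proof
      fix z assume "z \<in> S \<inter> {z. 0 < Im z}"
      then have "(Re (z - \<i> * of_real d), Im (z - \<i> * of_real d)) \<in> I"
        by (auto simp: S_def I_def)
      note velocity = has_field_derivative_velocity[OF this]
      have shift: "((\<lambda>z. z - \<i> * of_real d) has_field_derivative 1) (at z)"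
        by (auto intro!: derivative_eq_intros)
      have "\<exists>f'. ((\<lambda>z. Complex (u (Re (z - \<i> * of_real d), Im (z - \<i> * of_real d)) - c)
          (- v (Re (z - \<i> * of_real d), Im (z - \<i> * of_real d)))) has_field_derivative f') (at z)"
        by (rule exI, rule DERIV_chain2[where g = "\<lambda>z. z - \<i> * of_real d", OF velocity shift])
      then show "\<exists>f'. (G has_field_derivative f') (at z)"
        by (simp add: G_def[abs_def])
    qed
    show "continuous_on (S \<inter> {z. 0 \<le> Im z}) G"
      unfolding G_def Complex_eq
      by (intro continuous_intros continuous_on_compose2[OF continuous_fields(1)]
          continuous_on_compose2[OF continuous_fields(2)]) (auto simp: S_def fluid_domain_def)
    \<comment> \<open>Impermeability of the bed is exactly the reality condition of the reflection
      principle.\<close>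
    show "G z \<in> \<real>" if "z \<in> S" "z \<in> \<real>" for z
      using that by (auto simp: G_def complex_is_Real_iff bed)
  qed
  have in_range: "Complex (u z - c) (- v z) \<in> F ` S" if "z \<in> A" for z
  proof -
    obtain x y where z: "z = (x, y)" by (cases z)
    have "F (Complex x (y + d)) = Complex (u z - c) (- v z)" "Complex x (y + d) \<in> S"
      using that by (auto simp: z F_def G_def S_def A_def)
    then show ?thesis by (metis image_eqI)
  qed
  have range: "\<exists>z\<in>A. Re w = u z - c \<and> (norm w)\<^sup>2 = speed_sq z" if w: "w \<in> F ` S" for w
  proof -
    obtain \<zeta> where \<zeta>: "\<zeta> \<in> S" "w = F \<zeta>" using w by auto
    \<comment> \<open>The absolute value folds the mirror image back onto the fluid.\<close>
    then have "(Re \<zeta>, \<bar>Im \<zeta>\<bar> - d) \<in> A" by (auto simp: S_def A_def)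
    moreover have "Re w = u (Re \<zeta>, \<bar>Im \<zeta>\<bar> - d) - c" "(norm w)\<^sup>2 = speed_sq (Re \<zeta>, \<bar>Im \<zeta>\<bar> - d)"
      by (auto simp: \<zeta>(2) F_def G_def speed_sq_def cmod_power2 abs_if)
    ultimately show ?thesis by blast
  qed
  have "\<not> F constant_on S"
  proof
    assume "F constant_on S"
    then obtain a where a: "\<And>\<zeta>. \<zeta> \<in> S \<Longrightarrow> F \<zeta> = a" by (auto simp: constant_on_def)
    have "speed_sq z = (norm a)\<^sup>2" if "z \<in> I" for z
    proof -
      have "Complex (u z - c) (- v z) = a"
        using in_range[of z] I_subset_A that a by auto
      then show ?thesis by (auto simp: speed_sq_def cmod_power2)
    qed
    then show False by (rule speed_sq_not_const)
  qed
  then have "open (F ` S)"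
    by (intro open_mapping_thm[OF \<open>F holomorphic_on S\<close>] \<open>open S\<close> \<open>connected S\<close>) auto
  with in_range range show ?thesis by blast
qed

text \<open>The complex velocity at \<open>z\<close> lies in an open set of values, which extends to
  both sides in the real direction. Hence \<open>u\<close> has no extremum over \<open>A\<close> at
  a point of \<open>A\<close>.\<close>

lemma u_less_exists:
  assumes "z \<in> A"
  shows "\<exists>z'\<in>A. u z' < u z" "\<exists>z'\<in>A. u z < u z'"
proof -
  obtain T where T: "open T" "\<And>z. z \<in> A \<Longrightarrow> Complex (u z - c) (- v z) \<in> T"
    "\<And>w. w \<in> T \<Longrightarrow> \<exists>z\<in>A. Re w = u z - c"
    using open_velocity_range by metis
  show "\<exists>z'\<in>A. u z' < u z"
    using open_exists_Re_less[OF T(1) T(2)[OF assms]] T(3) by fastforce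
  show "\<exists>z'\<in>A. u z < u z'"
    using open_exists_Re_greater[OF T(1) T(2)[OF assms]] T(3) by fastforce
qed

text \<open>The same argument with the norm as the observable. The condition
  \<open>u z \<noteq> c\<close> keeps the complex velocity away from 0, where the norm is
  minimal.\<close>

lemma speed_sq_less_exists:
  assumes "z \<in> A"
  shows "\<exists>z'\<in>A. speed_sq z < speed_sq z'"
    and "u z \<noteq> c \<Longrightarrow> \<exists>z'\<in>A. speed_sq z' < speed_sq z"
proof -
  obtain T where T: "open T" "\<And>z. z \<in> A \<Longrightarrow> Complex (u z - c) (- v z) \<in> T"
    "\<And>w. w \<in> T \<Longrightarrow> \<exists>z\<in>A. (norm w)\<^sup>2 = speed_sq z"
    using open_velocity_range by metis
  have norm: "(norm (Complex (u z - c) (- v z)))\<^sup>2 = speed_sq z"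
    by (simp add: cmod_power2 speed_sq_def)
  show "\<exists>z'\<in>A. speed_sq z < speed_sq z'"
    using open_exists_norm_greater[OF T(1) T(2)[OF assms]] T(3) norm
    by (metis norm_ge_zero power_strict_mono zero_less_numeral)
  show "\<exists>z'\<in>A. speed_sq z' < speed_sq z" if "u z \<noteq> c"
  proof -
    have "Complex (u z - c) (- v z) \<noteq> 0" using that by (simp add: complex_eq_iff)
    from open_exists_norm_less[OF T(1) T(2)[OF assms] this] T(3) norm show ?thesis
      by (metis norm_ge_zero power_strict_mono zero_less_numeral)
  qed
qed

section \<open>Stagnation points and the sign of \<open>u - c\<close>\<close>

lemma surface_in_D: "(x, \<eta> x) \<in> D"
  using depth_pos[of x] by (auto simp: fluid_domain_def)

lemma D_cases:
  assumes "z \<in> D"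
  obtains "z \<in> A" | x where "z = (x, \<eta> x)"
proof (cases z)
  case (Pair x y)
  then show ?thesis
    using assms that by (cases "y = \<eta> x") (auto simp: fluid_domain_def A_def)
qed

lemma attains_inf_D:
  fixes f :: "real \<times> real \<Rightarrow> real"
  assumes "continuous_on D f" "\<And>x y. (x, y) \<in> D \<Longrightarrow> f (x + L, y) = f (x, y)"
  shows "\<exists>z\<in>D. \<forall>z'\<in>D. f z \<le> f z'"
  using assms
  by (intro continuous_on_periodic_attains_inf[OF L continuous_\<eta> \<eta>_periodic])
    (auto simp: fluid_domain_def depth_pos less_imp_le)

text \<open>Where \<open>u = c\<close> on the surface, the kinematic condition forces
  \<open>v = 0\<close>. At constant pressure Bernoulli's law makes the surface highest where the
  speed is least, so the point is a crest.\<close>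

lemma surface_stagnation:
  assumes "u (x, \<eta> x) = c"
  shows "\<exists>n::int. x = of_int n * L"
proof -
  obtain E where E: "\<And>z. z \<in> D \<Longrightarrow> P z / \<rho> + speed_sq z / 2 + g * snd z = E"
    using bernoulli by blast
  have "speed_sq (x, \<eta> x) = 0" using assms by (simp add: speed_sq_def kinematic)
  moreover have "0 \<le> speed_sq (0, \<eta> 0)" by (simp add: speed_sq_def)
  ultimately have "g * \<eta> 0 \<le> g * \<eta> x"
    using E[OF surface_in_D[of x]] E[OF surface_in_D[of 0]] by (simp add: dynamic)
  then have "\<eta> 0 \<le> \<eta> x" using g by simp
  then show ?thesis using \<eta>_le_crest[of x] \<eta>_eq_crest_iff[of x] by simp
qed

text \<open>Between successive crests \<open>u - c\<close> has no zero on the surface, so the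
  intermediate value theorem fixes its sign there. Continuity adds the crests, and periodicity the
  other periods.\<close>

lemma surface_sign:
  "(\<forall>x. c \<le> u (x, \<eta> x)) \<or> (\<forall>x. u (x, \<eta> x) \<le> c)"
proof -
  define w where "w x = u (x, \<eta> x) - c" for x
  have cont: "continuous_on X w" for X
    unfolding w_def
    by (intro continuous_intros continuous_on_compose2[OF continuous_fields(1)]
        continuous_on_subset[OF continuous_\<eta>]) (auto simp: surface_in_D)
  have per: "w (x + L) = w x" for x
    using field_periodic(1)[OF surface_in_D] by (simp add: w_def \<eta>_periodic)
  have nonzero: "w x \<noteq> 0" if "x \<in> {0<..<L}" for x
  proof
    assume "w x = 0"
    then obtain n :: int where "x = of_int n * L"
      using surface_stagnation by (auto simp: w_def)
    then have "0 < n" "n < 1" using that L by (auto simp: zero_less_mult_iff)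
    then show False by simp
  qed
  have "(\<forall>x\<in>{0<..<L}. 0 \<le> w x) \<or> (\<forall>x\<in>{0<..<L}. w x \<le> 0)"
  proof (rule ccontr)
    assume "\<not> ?thesis"
    then obtain a b where ab: "a \<in> {0<..<L}" "b \<in> {0<..<L}" "w a < 0" "0 < w b" by force
    have "connected (w ` {0<..<L})"
      by (intro connected_continuous_image cont) auto
    then have "0 \<in> w ` {0<..<L}"
      using ab connectedD_interval[of "w ` {0<..<L}" "w a" "w b" 0] by auto
    then show False using nonzero by auto
  qed
  \<comment> \<open>The factor \<open>s\<close>, later 1 or -1, treats both signs at once.\<close>
  moreover have extend: "0 \<le> s * w x" if s: "\<forall>x\<in>{0<..<L}. 0 \<le> s * w x" for s x
  proof -
    have "continuous_on (closure {0<..<L}) (\<lambda>x. s * w x)"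
      by (intro continuous_intros cont)
    then have closed: "0 \<le> s * w y" if "y \<in> {0..L}" for y
      using s that L continuous_ge_on_closure[of "{0<..<L}" "\<lambda>x. s * w x" y 0] by simp
    obtain n :: int where "x + of_int n * L \<in> {0..L}"
      using exists_int_shift_in_period[OF L] .
    from closed[OF this] show ?thesis
      by (simp add: periodic_int_shift[of w L, OF per])
  qed
  ultimately show ?thesis
    using extend[of 1] extend[of "-1"] by (auto simp: w_def)
qed

text \<open>An extremum of \<open>u\<close> over \<open>D\<close> cannot lie in \<open>A\<close>, so
  it lies on the surface and inherits the weak inequality. It is strict in \<open>A\<close>, since
  every value of \<open>u\<close> there is exceeded in both directions by other values.\<close>

lemma u_sign:
  "(\<forall>z\<in>A. c < u z) \<or> (\<forall>z\<in>A. u z < c)"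
  using surface_sign
proof
  assume surface: "\<forall>x. c \<le> u (x, \<eta> x)"
  obtain z where z: "z \<in> D" "\<And>z'. z' \<in> D \<Longrightarrow> u z \<le> u z'"
    using attains_inf_D[OF continuous_fields(1) field_periodic(1)] by blast
  from z(1) have "c \<le> u z"
  proof (cases rule: D_cases)
    case 1
    then show ?thesis using u_less_exists(1) z(2) A_subset_D by (meson in_mono not_less)
  qed (use surface in simp)
  then have "c < u z'" if "z' \<in> A" for z'
    using u_less_exists(1)[OF that] z(2) A_subset_D by (meson in_mono not_less order.trans)
  then show ?thesis by blast
next
  assume surface: "\<forall>x. u (x, \<eta> x) \<le> c"
  have "\<exists>z\<in>D. \<forall>z'\<in>D. - u z \<le> - u z'"
    by (intro attains_inf_D continuous_intros continuous_fields) (simp add: field_periodic)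
  then obtain z where z: "z \<in> D" "\<And>z'. z' \<in> D \<Longrightarrow> u z' \<le> u z" by auto
  from z(1) have "u z \<le> c"
  proof (cases rule: D_cases)
    case 1
    then show ?thesis using u_less_exists(2) z(2) A_subset_D by (meson in_mono not_less)
  qed (use surface in simp)
  then have "u z' < c" if "z' \<in> A" for z'
    using u_less_exists(2)[OF that] z(2) A_subset_D by (meson in_mono not_less order.trans)
  then show ?thesis by blast
qed

text \<open>Otherwise \<open>u - c\<close> would have mean zero along the bed, although it is
  continuous and of one strict sign there.\<close>

lemma current_strength_neq_c: "current_strength L d u \<noteq> c"
proof
  assume "current_strength L d u = c"
  then have int: "integral {0..L} (\<lambda>x. u (x, - d)) = L * c"
    using L by (simp add: current_strength_def field_simps)
  have bed_A: "(x, - d) \<in> A" for x using depth_pos[of x] by (simp add: A_def)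
  have cont: "continuous_on {0..L} (\<lambda>x. u (x, - d))"
    using A_subset_D bed_A
    by (intro continuous_on_compose2[OF continuous_fields(1)] continuous_intros) auto
  have "integral {0..L} (\<lambda>x. u (x, - d) - c) = 0"
    using int L integrable_continuous_real[OF cont]
    by (simp add: integral_diff integrable_const_ivl)
  then have zero: "integral {0..L} (\<lambda>x. s * (u (x, - d) - c)) = 0" for s
    by simp
  have False if pos: "\<forall>z\<in>A. 0 < s * (u z - c)" for s
  proof -
    have "continuous_on {0..L} (\<lambda>x. s * (u (x, - d) - c))" by (intro continuous_intros cont)
    moreover have "0 \<le> s * (u (x, - d) - c)" for x using pos bed_A[of x] by force
    ultimately have "\<forall>x\<in>{0..L}. s * (u (x, - d) - c) = 0"
      using zero[of s] L integral_eq_0_iff[of 0 L "\<lambda>x. s * (u (x, - d) - c)"] by blast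
    then have "s * (u (0, - d) - c) = 0" using L by (meson atLeastAtMost_iff less_imp_le order_refl)
    then show False using pos bed_A[of 0] by force
  qed
  from this[of 1] this[of "-1"] show False using u_sign by auto
qed

end

section \<open>Extrema of the dynamic pressure\<close>

theorem theorem3p1:
  fixes c L \<rho> g P\<^sub>a\<^sub>t\<^sub>m d k :: real
    and \<eta> :: "real \<Rightarrow> real"
    and u v P p :: "real \<times> real \<Rightarrow> real"
    and D :: "(real \<times> real) set"
  assumes "c > 0" and "L > 0" and "\<rho> > 0" and "g > 0" and "d > 0"
    and "regular_wave_train c L \<rho> g P\<^sub>a\<^sub>t\<^sub>m d \<eta> u v P"
    and "k = current_strength L d u" and "k \<noteq> 0"
    and "D = fluid_domain d \<eta>"
    and "p = dynamic_pressure \<rho> g P\<^sub>a\<^sub>t\<^sub>m P"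
  shows "(k \<noteq> c \<longrightarrow>
            {z. is_arg_max p (\<lambda>z. z \<in> D) z} = range (\<lambda>n::int. (of_int n * L, \<eta> 0)) \<and>
            {z. is_arg_min p (\<lambda>z. z \<in> D) z} = range (\<lambda>n::int. (L / 2 + of_int n * L, \<eta> (L / 2)))) \<and>
         (k = c \<longrightarrow> (\<forall>z\<in>D. p z = 0))"
proof -
  interpret wave_train c L \<rho> g P\<^sub>a\<^sub>t\<^sub>m d \<eta> u v P
    using assms by unfold_locales
  have D: "D = fluid_domain d \<eta>" by fact
  obtain E where E: "\<And>z. z \<in> D \<Longrightarrow> P z / \<rho> + speed_sq z / 2 + g * snd z = E"
    using bernoulli unfolding D by blast
  have p: "p z = P z - P\<^sub>a\<^sub>t\<^sub>m + \<rho> * g * snd z" for z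
    by (simp add: assms(10) dynamic_pressure_def case_prod_beta)
  \<comment> \<open>The hydrostatic term in \<open>p\<close> cancels the gravity term of Bernoulli's
    law, leaving only the speed.\<close>
  have p_speed: "p z = (\<rho> * E - P\<^sub>a\<^sub>t\<^sub>m) - \<rho> / 2 * speed_sq z" if "z \<in> D" for z
    unfolding p E[OF that, symmetric] using \<rho> by (simp add: field_simps)
  have less_iff: "p z < p z' \<longleftrightarrow> speed_sq z' < speed_sq z" if "z \<in> D" "z' \<in> D" for z z'
    using that \<rho> by (simp add: p_speed)
  have p_surface: "p (x, \<eta> x) = \<rho> * g * \<eta> x" for x
    by (simp add: p dynamic)
  have p_cont: "continuous_on D p"
    unfolding p D by (intro continuous_intros continuous_fields)
  have p_per: "p (x + L, y) = p (x, y)" if "(x, y) \<in> D" for x y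
    using field_periodic that by (simp add: p D)
  have A_less: "\<exists>z'\<in>D. p z < p z'" "\<exists>z'\<in>D. p z' < p z" if "z \<in> A" for z
  proof -
    \<comment> \<open>Excludes a stagnation point, where the speed could be minimal and the pressure
      maximal.\<close>
    have "u z \<noteq> c" using u_sign that by force
    then show "\<exists>z'\<in>D. p z < p z'" "\<exists>z'\<in>D. p z' < p z"
      using speed_sq_less_exists[OF that] A_subset_D less_iff that unfolding D by (meson in_mono)+
  qed
  have le_crest: "p z \<le> \<rho> * g * \<eta> 0" if "z \<in> D" for z
  proof -
    \<comment> \<open>A maximizer of \<open>p\<close> exists and cannot lie in \<open>A\<close>. It
      is thus on the surface, where \<open>p\<close> is a positive multiple of \<eta>.\<close>
    have "\<exists>z\<in>D. \<forall>z'\<in>D. - p z \<le> - p z'"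
      unfolding D using p_cont p_per by (intro attains_inf_D continuous_intros) (auto simp: D)
    then obtain m where m: "m \<in> D" "\<And>z'. z' \<in> D \<Longrightarrow> p z' \<le> p m" by auto
    have "m \<notin> A" using A_less(1) m(2) by (meson not_less)
    then obtain x where "m = (x, \<eta> x)" using m(1) unfolding D by (auto elim: D_cases)
    then have "p m \<le> \<rho> * g * \<eta> 0"
      using \<rho> g \<eta>_le_crest[of x] by (simp add: p_surface)
    with m(2)[OF that] show ?thesis by simp
  qed
  have ge_trough: "\<rho> * g * \<eta> (L / 2) \<le> p z" if "z \<in> D" for z
  proof -
    obtain m where m: "m \<in> D" "\<And>z'. z' \<in> D \<Longrightarrow> p m \<le> p z'"
      using attains_inf_D[of p] p_cont p_per unfolding D by blast
    have "m \<notin> A" using A_less(2) m(2) by (meson not_less)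
    then obtain x where "m = (x, \<eta> x)" using m(1) unfolding D by (auto elim: D_cases)
    then have "\<rho> * g * \<eta> (L / 2) \<le> p m"
      using \<rho> g \<eta>_ge_trough[of x] by (simp add: p_surface)
    with m(2)[OF that] show ?thesis by simp
  qed
  have surface: "(x, \<eta> x) \<in> D" for x unfolding D by (rule surface_in_D)
  have "is_arg_max p (\<lambda>z. z \<in> D) z \<longleftrightarrow> z \<in> range (\<lambda>n::int. (of_int n * L, \<eta> 0))" for z
  proof
    assume max: "is_arg_max p (\<lambda>z. z \<in> D) z"
    then have "z \<in> D" "z \<notin> A" using A_less(1)[of z] by (auto simp: is_arg_max_def)
    then obtain x where x: "z = (x, \<eta> x)" unfolding D by (auto elim: D_cases)
    have "\<not> p z < p (0, \<eta> 0)" using max surface by (auto simp: is_arg_max_def)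
    then have "\<eta> 0 \<le> \<eta> x" using \<rho> g by (simp add: x p_surface)
    then have "\<eta> x = \<eta> 0" using \<eta>_le_crest[of x] by simp
    then show "z \<in> range (\<lambda>n::int. (of_int n * L, \<eta> 0))"
      using \<eta>_eq_crest_iff[of x] x by auto
  next
    assume "z \<in> range (\<lambda>n::int. (of_int n * L, \<eta> 0))"
    then obtain x where x: "z = (x, \<eta> x)" "\<eta> x = \<eta> 0" using \<eta>_eq_crest_iff by auto
    then have "p z = \<rho> * g * \<eta> 0" using p_surface[of x] by simp
    then show "is_arg_max p (\<lambda>z. z \<in> D) z"
      using surface[of x] x le_crest by (auto simp: is_arg_max_def not_less)
  qed
  moreover have "is_arg_min p (\<lambda>z. z \<in> D) z \<longleftrightarrow>
    z \<in> range (\<lambda>n::int. (L / 2 + of_int n * L, \<eta> (L / 2)))" for z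
  proof
    assume min: "is_arg_min p (\<lambda>z. z \<in> D) z"
    then have "z \<in> D" "z \<notin> A" using A_less(2)[of z] by (auto simp: is_arg_min_def)
    then obtain x where x: "z = (x, \<eta> x)" unfolding D by (auto elim: D_cases)
    have "\<not> p (L / 2, \<eta> (L / 2)) < p z" using min surface by (auto simp: is_arg_min_def)
    then have "\<eta> x \<le> \<eta> (L / 2)" using \<rho> g by (simp add: x p_surface)
    then have "\<eta> x = \<eta> (L / 2)" using \<eta>_ge_trough[of x] by simp
    then show "z \<in> range (\<lambda>n::int. (L / 2 + of_int n * L, \<eta> (L / 2)))"
      using \<eta>_eq_trough_iff[of x] x by auto
  next
    assume "z \<in> range (\<lambda>n::int. (L / 2 + of_int n * L, \<eta> (L / 2)))"
    then obtain x where x: "z = (x, \<eta> x)" "\<eta> x = \<eta> (L / 2)" using \<eta>_eq_trough_iff by auto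
    then have "p z = \<rho> * g * \<eta> (L / 2)" using p_surface[of x] by simp
    then show "is_arg_min p (\<lambda>z. z \<in> D) z"
      using surface[of x] x ge_trough by (auto simp: is_arg_min_def not_less)
  qed
  \<comment> \<open>Contradicts the premise of the second conjunct.\<close>
  moreover have "k \<noteq> c" using current_strength_neq_c assms(7) by simp
  ultimately show ?thesis by blast
qed

end
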